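(* Let $G=(V,E)$ be a finite connected weighted graph with positive symmetric edge weights $\omega_{xy}$ and positive vertex measure $\mu$, let $N\ge 1$ be an integer and let $p_1,\dots,p_N\in V$ be distinct vertices. For $\lambda>0$ consider the equation $$\Delta u=-\lambda e^{g(u)}\left(e^{g(u)}-1\right)^2+4\pi\sum_{j=1}^{N}\delta_{p_j}\quad\text{on } V, \qquad (\ast)_\lambda$$ where $g$ is the inverse function of $f(\upsilon)=1+\upsilon-e^{\upsilon}$ on $(-\infty,0]$. Then there exists a critical value $\lambda_c$ satisfying $$\lambda_c\ge\frac{27\pi N}{|V|}$$ such that: if $\lambda\ge\lambda_c$, then $(\ast)_\lambda$ has a negative solution (a solution $u$ with $u(x)<0$ for all $x\in V$); and if $0<\lambda<\lambda_c$, then $(\ast)_\lambda$ has no solution.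
   Context: $G=(V,E)$ is a finite connected graph: $V$ is a finite nonempty vertex set, $E$ the edge set, $y\sim x$ means $xy\in E$, and any two vertices can be joined by a finite chain of edges. Each edge $xy\in E$ has a weight $\omega_{xy}>0$ with $\omega_{xy}=\omega_{yx}$, and $\mu:V\to(0,\infty)$ is a measure. For $u:V\to\mathbb{R}$, the $\mu$-Laplacian is $\Delta u(x)=\frac{1}{\mu(x)}\sum_{y\sim x}\omega_{xy}(u(y)-u(x))$, and $\int_V u\,d\mu=\sum_{x\in V}\mu(x)u(x)$. The volume is $|V|=\sum_{x\in V}\mu(x)$. The Dirac mass $\delta_{p}$ at $p\in V$ is the function with $\delta_p(p)=1/\mu(p)$ and $\delta_p(x)=0$ for $x\ne p$, so that $\int_V\delta_p\,d\mu=1$. The function $f(\upsilon)=1+\upsilon-e^{\upsilon}$ is a strictly increasing bijection of $(-\infty,0]$ onto $(-\infty,0]$, and $g:(-\infty,0]\to(-\infty,0]$ is its inverse. Since $g$ is defined only on $(-\infty,0]$, a solution of the equation is a function $u:V\to(-\infty,0]$ satisfying it at every vertex. *)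

theory Defs
  imports Complex_Main "Graph_Theory.Digraph_Component"
begin

text \<open>
  An undirected graph is a symmetric digraph: an edge \<open>xy\<close> is the pair of arcs \<open>(x, y)\<close>, \<open>(y, x)\<close>.
  Loops are not excluded; they contribute nothing to the Laplacian. Connectedness includes
  nonemptiness of the vertex set. Functions on the vertex set are total functions whose
  values outside \<open>pverts G\<close> are irrelevant.
\<close>

locale connected_weighted_graph = pair_pseudo_graph G
  for G :: "'a pair_pre_digraph" +
  fixes \<omega> :: "'a \<Rightarrow> 'a \<Rightarrow> real" and \<mu> :: "'a \<Rightarrow> real"
  assumes graph_connected: "Digraph_Component.connected (with_proj G)"
    and weight_pos: "(x, y) \<in> parcs G \<Longrightarrow> \<omega> x y > 0"
    and weight_sym: "(x, y) \<in> parcs G \<Longrightarrow> \<omega> x y = \<omega> y x"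
    and measure_pos: "x \<in> pverts G \<Longrightarrow> \<mu> x > 0"

definition graph_laplacian ::
    "'a pair_pre_digraph \<Rightarrow> ('a \<Rightarrow> 'a \<Rightarrow> real) \<Rightarrow> ('a \<Rightarrow> real) \<Rightarrow> ('a \<Rightarrow> real) \<Rightarrow> 'a \<Rightarrow> real" where
  "graph_laplacian G \<omega> \<mu> u x =
     1 / \<mu> x * (\<Sum>y\<in>{y \<in> pverts G. (x, y) \<in> parcs G}. \<omega> x y * (u y - u x))"

definition graph_volume :: "'a pair_pre_digraph \<Rightarrow> ('a \<Rightarrow> real) \<Rightarrow> real" where
  "graph_volume G \<mu> = (\<Sum>x\<in>pverts G. \<mu> x)"

definition dirac_mass :: "('a \<Rightarrow> real) \<Rightarrow> 'a \<Rightarrow> 'a \<Rightarrow> real" where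
  "dirac_mass \<mu> p x = (if x = p then 1 / \<mu> p else 0)"

definition f_fun :: "real \<Rightarrow> real" where
  "f_fun v = 1 + v - exp v"

text \<open>Only the values of \<open>g_fun\<close> on \<open>{..0}\<close> are meaningful; see \<open>g_fun_inverse\<close> below.\<close>

definition g_fun :: "real \<Rightarrow> real" where
  "g_fun = inv_into {..0} f_fun"

definition is_solution ::
    "'a pair_pre_digraph \<Rightarrow> ('a \<Rightarrow> 'a \<Rightarrow> real) \<Rightarrow> ('a \<Rightarrow> real) \<Rightarrow> nat \<Rightarrow> (nat \<Rightarrow> 'a) \<Rightarrow> real
      \<Rightarrow> ('a \<Rightarrow> real) \<Rightarrow> bool" where
  "is_solution G \<omega> \<mu> N p lam u \<longleftrightarrow>
     (\<forall>x\<in>pverts G. u x \<le> 0 \<and>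
        graph_laplacian G \<omega> \<mu> u x =
          - lam * exp (g_fun (u x)) * (exp (g_fun (u x)) - 1)\<^sup>2
          + 4 * pi * (\<Sum>j = 1..N. dirac_mass \<mu> (p j) x))"

lemma f_fun_strict_mono: "strict_mono_on {..0} f_fun"
proof (rule strict_mono_onI)
  fix a b :: real
  assume "a \<in> {..0}" "b \<in> {..0}" "a < b"
  then have b: "b \<le> 0" and ab: "a < b" by auto
  have "1 + (a - b) < exp (a - b)"
    using ab exp_minus_greater[of "b - a"] by simp
  moreover have "exp b * (1 - exp (a - b)) \<le> 1 * (1 - exp (a - b))"
    using b ab by (intro mult_right_mono) auto
  ultimately have "exp b - exp b * exp (a - b) < b - a"
    by (simp add: algebra_simps)
  then show "f_fun a < f_fun b"
    by (simp add: f_fun_def exp_diff)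
qed

lemma f_fun_bij: "bij_betw f_fun {..0} {..0}"
proof -
  have le: "f_fun v \<le> 0" for v
    using exp_ge_add_one_self[of v] by (simp add: f_fun_def)
  have "\<exists>v\<le>0. f_fun v = y" if y: "y \<le> 0" for y
  proof -
    have "f_fun (y - 1) \<le> y" by (simp add: f_fun_def)
    moreover have "y \<le> f_fun 0" using y by (simp add: f_fun_def)
    moreover have "\<forall>v. y - 1 \<le> v \<and> v \<le> 0 \<longrightarrow> isCont f_fun v"
      unfolding f_fun_def by (auto intro!: continuous_intros)
    ultimately show ?thesis using IVT[of f_fun "y - 1" y 0] y by auto
  qed
  then have "f_fun ` {..0} = {..0}" using le by force
  then show ?thesis
    using strict_mono_on_imp_inj_on[OF f_fun_strict_mono] by (simp add: bij_betw_def)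
qed

lemma g_fun_inverse:
  shows "v \<le> 0 \<Longrightarrow> g_fun (f_fun v) = v"
    and "y \<le> 0 \<Longrightarrow> g_fun y \<le> 0"
    and "y \<le> 0 \<Longrightarrow> f_fun (g_fun y) = y"
  using f_fun_bij bij_betw_inv_into_left[OF f_fun_bij] bij_betw_inv_into_right[OF f_fun_bij]
    bij_betw_apply[OF bij_betw_inv_into[OF f_fun_bij]]
  by (auto simp: g_fun_def)

end

theory Submission
  imports Defs
begin

text \<open>
  Write the equation as \<open>\<Delta>u = -\<lambda> h(u) + \<rho>\<close> with \<open>h(t) = e\<^bsup>g(t)\<^esup>(e\<^bsup>g(t)\<^esup> - 1)\<^sup>2\<close>.
  Since \<open>t \<mapsto> h(t) + 2t\<close> is nondecreasing on \<open>t \<le> 0\<close>, solutions are the fixed points of a monotone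
  operator, and \<open>0\<close> is an upper solution. By the Knaster--Tarski argument the pointwise supremum of
  all lower solutions is a solution as soon as one lower solution exists. A lower solution for
  \<open>\<lambda>\<close> is one for every larger \<open>\<lambda>\<close>, and a constant is one for large \<open>\<lambda>\<close>, so
  the solvable \<open>\<lambda>\<close> form an up-closed set; \<open>\<lambda>\<^sub>c\<close> is its infimum. Integration over the graph
  gives \<open>\<lambda> \<integral>h(u) = 4\<pi>N\<close>, whence the bound by \<open>h \<le> 4/27\<close>. The same identity together with
  \<open>h(t) \<le> e\<^sup>t\<close> keeps \<open>max u\<close> away from \<open>-\<infinity>\<close>, and connectedness then bounds the solutions from
  below, so that the decreasing maximal solutions for \<open>\<lambda> \<down> \<lambda>\<^sub>c\<close> converge to a solution
  for \<open>\<lambda>\<^sub>c\<close>. The maximum principle makes every solution negative.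
\<close>

section \<open>The nonlinearity \<open>h_fun\<close>: bounds and Lipschitz estimates\<close>

definition h_fun :: "real \<Rightarrow> real" where
  "h_fun t = exp (g_fun t) * (exp (g_fun t) - 1)\<^sup>2"

lemma g_fun_mono:
  assumes "s \<le> t" "t \<le> 0"
  shows "g_fun s \<le> g_fun t"
proof (rule ccontr)
  assume "\<not> g_fun s \<le> g_fun t"
  then have "f_fun (g_fun t) < f_fun (g_fun s)"
    using strict_mono_onD[OF f_fun_strict_mono] g_fun_inverse(2) assms by simp
  then show False using assms by (simp add: g_fun_inverse(3))
qed

lemma h_fun_zero: "h_fun 0 = 0"
proof -
  have "g_fun 0 = 0" using g_fun_inverse(1)[of 0] by (simp add: f_fun_def)
  then show ?thesis by (simp add: h_fun_def)
qed

lemma h_fun_nonneg: "0 \<le> h_fun t"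
  by (simp add: h_fun_def)

lemma h_fun_le:
  assumes "t \<le> 0"
  shows "h_fun t \<le> 4 / 27"
proof -
  define s where "s = exp (g_fun t)"
  have "s \<le> 1" using g_fun_inverse(2)[OF assms] by (simp add: s_def)
  \<comment> \<open>\<open>s = 1/3\<close> maximises \<open>s * (s - 1)\<^sup>2\<close> on the unit
    interval, so the gap to the maximal value \<open>4/27\<close> has a double root there.\<close>
  then have "0 \<le> (s - 1/3)\<^sup>2 * (4/3 - s)" by simp
  also have "\<dots> = 4/27 - s * (s - 1)\<^sup>2"
    by (simp add: power2_eq_square algebra_simps)
  finally show ?thesis by (simp add: h_fun_def s_def)
qed

text \<open>The squared factor is at most 1, and \<open>g_fun t = t - 1 + exp (g_fun t)\<close> is
  at most \<open>t\<close>. This makes the nonlinearity small where a solution is very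
  negative.\<close>

lemma h_fun_le_exp:
  assumes "t \<le> 0"
  shows "h_fun t \<le> exp t"
proof -
  define s where "s = exp (g_fun t)"
  have g: "g_fun t \<le> 0" and f: "1 + g_fun t - s = t"
    using g_fun_inverse[of t] assms by (auto simp: f_fun_def s_def)
  have s: "0 \<le> s" "s \<le> 1" using g by (auto simp: s_def)
  then have "(s - 1)\<^sup>2 \<le> 1" by (simp add: abs_square_le_1)
  then have "h_fun t \<le> s" using s by (simp add: h_fun_def s_def[symmetric] mult_left_le)
  also have "s = exp (g_fun t)" by (simp add: s_def)
  also have "\<dots> \<le> exp t" using f s by simp
  finally show ?thesis .
qed

text \<open>The derivatives in \<open>v\<close> below factor with \<open>1 - e\<^sup>v\<close>; hence \<open>-2 \<le> h' \<le> 1\<close> on the negative axis.\<close>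

lemma
  assumes "s \<le> t" "t \<le> 0"
  shows h_fun_lower_lipschitz: "h_fun s + 2 * s \<le> h_fun t + 2 * t"
    and h_fun_upper_lipschitz: "s - h_fun s \<le> t - h_fun t"
proof -
  define a b where "a = g_fun s" and "b = g_fun t"
  have ab: "a \<le> b" "b \<le> 0"
    using g_fun_mono[OF assms] g_fun_inverse(2)[OF assms(2)] by (auto simp: a_def b_def)
  have f: "f_fun a = s" "f_fun b = t"
    using assms g_fun_inverse(3) by (auto simp: a_def b_def)
  define F where "F v = exp v * (exp v - 1)\<^sup>2 + 2 * f_fun v" for v :: real
  define H where "H v = f_fun v - exp v * (exp v - 1)\<^sup>2" for v :: real
  have "F a \<le> F b"
  proof (rule DERIV_nonneg_imp_nondecreasing[OF ab(1)])
    fix v assume "a \<le> v" "v \<le> b"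
    have "(F has_real_derivative ((1 - exp v)\<^sup>2 * (2 + 3 * exp v))) (at v)"
      unfolding F_def f_fun_def
      by (rule derivative_eq_intros refl | simp)+ (simp add: power2_eq_square algebra_simps)
    then show "\<exists>y. DERIV F v :> y \<and> 0 \<le> y"
      by (intro exI conjI) (auto intro!: mult_nonneg_nonneg add_nonneg_nonneg)
  qed
  then show "h_fun s + 2 * s \<le> h_fun t + 2 * t"
    using f by (simp add: F_def h_fun_def a_def b_def)
  have "H a \<le> H b"
  proof (rule DERIV_nonneg_imp_nondecreasing[OF ab(1)])
    fix v assume "a \<le> v" "v \<le> b"
    then have "exp v \<le> 1" using ab by simp
    moreover have "0 \<le> 1 - exp v + 3 * (exp v)\<^sup>2" using calculation by simp
    ultimately have "0 \<le> (1 - exp v) * (1 - exp v + 3 * (exp v)\<^sup>2)" by simp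
    moreover have "(H has_real_derivative ((1 - exp v) * (1 - exp v + 3 * (exp v)\<^sup>2))) (at v)"
      unfolding H_def f_fun_def
      by (rule derivative_eq_intros refl | simp)+ (simp add: power2_eq_square algebra_simps)
    ultimately show "\<exists>y. DERIV H v :> y \<and> 0 \<le> y" by blast
  qed
  then show "s - h_fun s \<le> t - h_fun t"
    using f by (simp add: H_def h_fun_def a_def b_def)
qed

lemma tendsto_h_fun:
  assumes lim: "X \<longlonglongrightarrow> l" and X: "\<And>n. X n \<le> 0"
  shows "(\<lambda>n. h_fun (X n)) \<longlonglongrightarrow> h_fun l"
proof -
  have l: "l \<le> 0" using LIMSEQ_le_const2[OF lim] X by blast
  \<comment> \<open>The two one-sided estimates confine every difference quotient of
    \<open>h_fun\<close> to \<open>[-2, 1]\<close>.\<close>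
  have lip: "\<bar>h_fun s - h_fun t\<bar> \<le> 2 * \<bar>s - t\<bar>" if "s \<le> 0" "t \<le> 0" for s t
    using h_fun_lower_lipschitz[of s t] h_fun_upper_lipschitz[of s t]
      h_fun_lower_lipschitz[of t s] h_fun_upper_lipschitz[of t s] that
    by (cases "s \<le> t") auto
  have "(\<lambda>n. 2 * \<bar>X n - l\<bar>) \<longlonglongrightarrow> 0"
    using tendsto_mult_right_zero[OF tendsto_rabs_zero[OF LIM_zero[OF lim]]] by simp
  then have "(\<lambda>n. h_fun (X n) - h_fun l) \<longlonglongrightarrow> 0"
    by (rule tendsto_0_le[where K = 1]) (use lip X l in auto)
  then show ?thesis by (rule LIM_zero_cancel)
qed

section \<open>The Laplacian, lower solutions and connectedness\<close>

context connected_weighted_graph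
begin

abbreviation laplacian :: "('a \<Rightarrow> real) \<Rightarrow> 'a \<Rightarrow> real" where
  "laplacian \<equiv> graph_laplacian G \<omega> \<mu>"

abbreviation nbrs :: "'a \<Rightarrow> 'a set" where
  "nbrs x \<equiv> {y \<in> pverts G. (x, y) \<in> parcs G}"

text \<open>The off-diagonal part of the Laplacian. At the constant function 1 it is the weighted
  degree divided by \<open>\<mu> x\<close>, the coefficient of \<open>- u x\<close> in
  \<open>laplacian_eq\<close>.\<close>

definition nbr_sum :: "('a \<Rightarrow> real) \<Rightarrow> 'a \<Rightarrow> real" where
  "nbr_sum u x = 1 / \<mu> x * (\<Sum>y\<in>nbrs x. \<omega> x y * u y)"

definition lower_solution :: "('a \<Rightarrow> real) \<Rightarrow> real \<Rightarrow> ('a \<Rightarrow> real) \<Rightarrow> bool" where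
  "lower_solution \<rho> lam u \<longleftrightarrow>
     (\<forall>x\<in>pverts G. u x \<le> 0 \<and> - lam * h_fun (u x) + \<rho> x \<le> laplacian u x)"

text \<open>An arbitrary source \<open>\<rho>\<close> stands in for the Dirac masses, of which only
  nonnegativity and total mass matter below.\<close>

definition exact_solution :: "('a \<Rightarrow> real) \<Rightarrow> real \<Rightarrow> ('a \<Rightarrow> real) \<Rightarrow> bool" where
  "exact_solution \<rho> lam u \<longleftrightarrow>
     (\<forall>x\<in>pverts G. u x \<le> 0 \<and> laplacian u x = - lam * h_fun (u x) + \<rho> x)"

lemma exact_imp_lower: "exact_solution \<rho> lam u \<Longrightarrow> lower_solution \<rho> lam u"
  by (simp add: exact_solution_def lower_solution_def)

lemma lower_solution_mono:
  assumes "lower_solution \<rho> lam u" "lam \<le> lam'"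
  shows "lower_solution \<rho> lam' u"
  unfolding lower_solution_def
proof
  fix x assume "x \<in> pverts G"
  then show "u x \<le> 0 \<and> - lam' * h_fun (u x) + \<rho> x \<le> laplacian u x"
    using assms(1) mult_right_mono[OF assms(2) h_fun_nonneg, of "u x"]
    by (auto simp: lower_solution_def)
qed

lemma finite_nbrs: "finite (nbrs x)"
  using pair_finite_verts by simp

lemma laplacian_eq: "laplacian u x = nbr_sum u x - nbr_sum (\<lambda>_. 1) x * u x"
  by (simp add: graph_laplacian_def nbr_sum_def right_diff_distrib sum_subtractf
      sum_distrib_right flip: mult.assoc)

lemma nbr_sum_mono:
  assumes "x \<in> pverts G" "\<And>y. y \<in> pverts G \<Longrightarrow> u y \<le> v y"
  shows "nbr_sum u x \<le> nbr_sum v x"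
  unfolding nbr_sum_def using assms measure_pos[OF assms(1)] weight_pos
  by (intro mult_left_mono sum_mono) (auto simp: less_imp_le)

lemma nbr_sum_one_nonneg: "x \<in> pverts G \<Longrightarrow> 0 \<le> nbr_sum (\<lambda>_. 1) x"
  unfolding nbr_sum_def using measure_pos[of x] weight_pos
  by (intro mult_nonneg_nonneg sum_nonneg) (auto simp: less_imp_le)

lemma parcs_sym: "(x, y) \<in> parcs G \<Longrightarrow> (y, x) \<in> parcs G"
  using pair_sym_arcs by (auto simp: symmetric_def sym_def)

lemma verts_nonempty: "pverts G \<noteq> {}"
  using graph_connected by (auto simp: connected_def strongly_connected_def)

lemma volume_pos: "0 < graph_volume G \<mu>"
  unfolding graph_volume_def
  using pair_finite_verts verts_nonempty measure_pos by (intro sum_pos) auto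

text \<open>Connectedness as an induction principle: arcs come in symmetric pairs, so every vertex
  is reachable from \<open>x\<close> along directed arcs.\<close>

lemma vertex_induct:
  assumes "x \<in> pverts G" "y \<in> pverts G" "P x"
    and step: "\<And>a b. (a, b) \<in> parcs G \<Longrightarrow> P a \<Longrightarrow> P b"
  shows "P y"
proof -
  have "strongly_connected (with_proj G)"
    using graph_connected symmetric_connected_imp_strongly_connected pair_sym_arcs by simp
  then have "x \<rightarrow>\<^sup>*\<^bsub>with_proj G\<^esub> y"
    using assms by (auto simp: strongly_connected_def)
  then show ?thesis
    by (induction rule: reachable_induct) (use assms in auto)
qed

section \<open>Integration over the graph and the maximum principle\<close>

text \<open>Summed against \<open>\<mu>\<close>, the Laplacian becomes a double sum of the
  antisymmetric flux \<open>k\<close>, which equals its own negative.\<close>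

lemma integral_laplacian: "(\<Sum>x\<in>pverts G. \<mu> x * laplacian u x) = 0"
proof -
  define k where "k x y = (if (x, y) \<in> parcs G then \<omega> x y * (u y - u x) else 0)" for x y
  have "\<mu> x * laplacian u x = (\<Sum>y\<in>pverts G. k x y)" if "x \<in> pverts G" for x
  proof -
    have "\<mu> x * laplacian u x = (\<Sum>y\<in>nbrs x. \<omega> x y * (u y - u x))"
      using measure_pos[OF that] by (simp add: graph_laplacian_def)
    also have "\<dots> = (\<Sum>y\<in>pverts G. k x y)"
      unfolding k_def using pair_finite_verts by (rule sum.inter_filter)
    finally show ?thesis .
  qed
  then have eq: "(\<Sum>x\<in>pverts G. \<mu> x * laplacian u x) = (\<Sum>x\<in>pverts G. \<Sum>y\<in>pverts G. k x y)"
    by (rule sum.cong[OF refl])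
  have anti: "k x y = - k y x" for x y
    using parcs_sym weight_sym by (auto simp: k_def algebra_simps)
  have "(\<Sum>x\<in>pverts G. \<Sum>y\<in>pverts G. k x y) = - (\<Sum>x\<in>pverts G. \<Sum>y\<in>pverts G. k y x)"
    by (subst anti) (simp add: sum_negf)
  also have "(\<Sum>x\<in>pverts G. \<Sum>y\<in>pverts G. k y x) = (\<Sum>x\<in>pverts G. \<Sum>y\<in>pverts G. k x y)"
    by (rule sum.swap)
  finally show ?thesis using eq by simp
qed

lemma integral_identity:
  assumes "exact_solution \<rho> lam u"
  shows "lam * (\<Sum>x\<in>pverts G. \<mu> x * h_fun (u x)) = (\<Sum>x\<in>pverts G. \<mu> x * \<rho> x)"
proof -
  have "0 = (\<Sum>x\<in>pverts G. \<mu> x * (- lam * h_fun (u x) + \<rho> x))"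
    using integral_laplacian[of u] assms by (simp add: exact_solution_def)
  also have "\<dots> = - lam * (\<Sum>x\<in>pverts G. \<mu> x * h_fun (u x)) + (\<Sum>x\<in>pverts G. \<mu> x * \<rho> x)"
    by (simp add: distrib_left sum.distrib sum_distrib_left sum_negf mult_ac sum_subtractf right_diff_distrib)
  finally show ?thesis by simp
qed

lemma lam_bound:
  assumes "exact_solution \<rho> lam u" "0 < lam"
  shows "27 / 4 * (\<Sum>x\<in>pverts G. \<mu> x * \<rho> x) / graph_volume G \<mu> \<le> lam"
proof -
  have "(\<Sum>x\<in>pverts G. \<mu> x * h_fun (u x)) \<le> (\<Sum>x\<in>pverts G. \<mu> x * (4 / 27))"
    using assms measure_pos h_fun_le
    by (intro sum_mono mult_left_mono) (auto simp: exact_solution_def less_imp_le)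
  also have "\<dots> = graph_volume G \<mu> * (4 / 27)"
    unfolding graph_volume_def by (rule sum_distrib_right[symmetric])
  finally have "(\<Sum>x\<in>pverts G. \<mu> x * \<rho> x) \<le> lam * (graph_volume G \<mu> * (4 / 27))"
    using assms(2) by (simp flip: integral_identity[OF assms(1)])
  then show ?thesis using volume_pos by (simp add: field_simps)
qed

text \<open>Strong maximum principle: a zero of \<open>u\<close> is a maximum, it forces zeros at
  all neighbours, and connectedness spreads them everywhere. Then \<open>h_fun (u x)\<close>
  vanishes identically, against the positive mass in \<open>integral_identity\<close>.\<close>

lemma exact_solution_negative:
  assumes sol: "exact_solution \<rho> lam u"
    and \<rho>: "\<And>x. x \<in> pverts G \<Longrightarrow> 0 \<le> \<rho> x"
    and mass: "0 < (\<Sum>x\<in>pverts G. \<mu> x * \<rho> x)"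
    and x: "x \<in> pverts G"
  shows "u x < 0"
proof (rule ccontr)
  assume "\<not> u x < 0"
  with sol x have "u x = 0" by (force simp: exact_solution_def)
  have step: "u b = 0" if ab: "(a, b) \<in> parcs G" and a: "u a = 0" for a b
  proof -
    have V: "a \<in> pverts G" "b \<in> pverts G" using ab wellformed' by auto
    have "0 \<le> laplacian u a"
      using sol V a \<rho> by (simp add: exact_solution_def h_fun_zero)
    then have "0 \<le> (\<Sum>y\<in>nbrs a. \<omega> a y * u y)"
      using a measure_pos[OF V(1)] by (simp add: graph_laplacian_def zero_le_divide_iff)
    moreover have np: "\<omega> a y * u y \<le> 0" if "y \<in> nbrs a" for y
      using that sol weight_pos[of a y] by (auto simp: exact_solution_def mult_le_0_iff)
    ultimately have "(\<Sum>y\<in>nbrs a. - (\<omega> a y * u y)) = 0"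
      using sum_nonpos[of "nbrs a" "\<lambda>y. \<omega> a y * u y"] by (simp add: sum_negf)
    then have "- (\<omega> a b * u b) = 0"
      using sum_nonneg_eq_0_iff[OF finite_nbrs, of a "\<lambda>y. - (\<omega> a y * u y)"] np ab V
      by force
    then show ?thesis using weight_pos[OF ab] by simp
  qed
  have "u y = 0" if "y \<in> pverts G" for y
    using vertex_induct[OF x that, of "\<lambda>z. u z = 0"] \<open>u x = 0\<close> step by blast
  then have "(\<Sum>x\<in>pverts G. \<mu> x * h_fun (u x)) = 0"
    by (simp add: h_fun_zero)
  then show False using integral_identity[OF sol] mass by simp
qed

section \<open>The maximal solution above a lower solution\<close>

lemma maximal_solution:
  assumes lam: "0 < lam"
    and \<rho>: "\<And>x. x \<in> pverts G \<Longrightarrow> 0 \<le> \<rho> x"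
    and v0: "lower_solution \<rho> lam v0"
  obtains w where "exact_solution \<rho> lam w"
    and "\<And>v x. lower_solution \<rho> lam v \<Longrightarrow> x \<in> pverts G \<Longrightarrow> v x \<le> w x"
proof -
  \<comment> \<open>Adding \<open>2 * lam * u x\<close> to both sides makes the right-hand side of
    the fixed-point equation monotone, by \<open>h_fun_lower_lipschitz\<close>. The same shift keeps
    \<open>c x\<close> positive even at a vertex without neighbours.\<close>
  define c where "c x = nbr_sum (\<lambda>_. 1) x + 2 * lam" for x
  define T where "T u x = (nbr_sum u x + lam * (h_fun (u x) + 2 * u x) - \<rho> x) / c x" for u x
  have c: "0 < c x" if "x \<in> pverts G" for x
    using nbr_sum_one_nonneg[OF that] lam by (simp add: c_def)
  have T_le: "v x \<le> T v x \<longleftrightarrow> - lam * h_fun (v x) + \<rho> x \<le> laplacian v x"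
    if "x \<in> pverts G" for v x
    using c[OF that] by (auto simp: T_def pos_le_divide_eq laplacian_eq c_def algebra_simps)
  have T_eq: "laplacian v x = - lam * h_fun (v x) + \<rho> x"
    if "x \<in> pverts G" "v x = T v x" for v x
  proof -
    have "v x * c x = nbr_sum v x + lam * (h_fun (v x) + 2 * v x) - \<rho> x"
      using that c[OF that(1)] by (simp add: T_def nonzero_eq_divide_eq)
    then show ?thesis by (simp add: laplacian_eq c_def algebra_simps)
  qed
  have T_mono: "T u x \<le> T v x"
    if "x \<in> pverts G" "\<And>y. y \<in> pverts G \<Longrightarrow> u y \<le> v y" "\<And>y. y \<in> pverts G \<Longrightarrow> v y \<le> 0" for u v x
    unfolding T_def
    by (intro divide_right_mono diff_right_mono add_mono mult_left_mono nbr_sum_mono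
        h_fun_lower_lipschitz) (use that c lam in \<open>auto simp: less_imp_le\<close>)
  have T_zero: "T (\<lambda>_. 0) x \<le> 0" if "x \<in> pverts G" for x
    using c[OF that] \<rho>[OF that] by (simp add: T_def nbr_sum_def h_fun_zero)
  define S where "S = {v. lower_solution \<rho> lam v}"
  define w where "w x = (SUP v\<in>S. v x)" for x
  have S_le: "v x \<le> 0" "v x \<le> T v x" if "v \<in> S" "x \<in> pverts G" for v x
    using that T_le by (auto simp: S_def lower_solution_def)
  have S_ne: "S \<noteq> {}" using v0 by (auto simp: S_def)
  have upper: "v x \<le> w x" if "v \<in> S" "x \<in> pverts G" for v x
    unfolding w_def using that S_le by (intro cSUP_upper bdd_aboveI2[where M = 0]) auto
  have w0: "w x \<le> 0" if "x \<in> pverts G" for x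
    unfolding w_def using that S_le S_ne by (intro cSUP_least) auto
  have wT: "w x \<le> T w x" if "x \<in> pverts G" for x
  proof -
    have "v x \<le> T w x" if "v \<in> S" for v
      using S_le(2)[OF that \<open>x \<in> pverts G\<close>] T_mono[of x v w] upper[OF that] w0 \<open>x \<in> pverts G\<close>
      by fastforce
    then show ?thesis unfolding w_def using S_ne by (intro cSUP_least) (auto simp: w_def)
  qed
  have Tw0: "T w x \<le> 0" if "x \<in> pverts G" for x
    using T_mono[of x w "\<lambda>_. 0"] T_zero[OF that] w0 that by fastforce
  \<comment> \<open>Monotonicity turns \<open>w \<le> T w\<close> into
    \<open>T w \<le> T (T w)\<close>, so \<open>T w\<close> is again a lower solution and lies below
    the supremum \<open>w\<close>.\<close>
  have "T w \<in> S"
  proof -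
    have "T w x \<le> T (T w) x" if "x \<in> pverts G" for x
      using T_mono[OF that] wT Tw0 by blast
    then show ?thesis using Tw0 T_le by (simp add: S_def lower_solution_def)
  qed
  then have "T w x \<le> w x" if "x \<in> pverts G" for x
    using upper that by blast
  then have "exact_solution \<rho> lam w"
    unfolding exact_solution_def using wT w0 T_eq[OF _ antisym] by blast
  then show ?thesis using that upper by (auto simp: S_def)
qed

section \<open>A priori lower bounds\<close>

text \<open>The bound on the Laplacian at \<open>a\<close> bounds the weighted neighbour sum from
  below. Its terms are all nonpositive, so dropping those other than \<open>b\<close> leaves a bound
  for \<open>v b\<close>.\<close>

lemma harnack_step:
  assumes ab: "(a, b) \<in> parcs G"
    and neg: "\<And>x. x \<in> pverts G \<Longrightarrow> v x \<le> 0"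
    and lap: "- C \<le> laplacian v a" and m: "m \<le> v a"
  shows "\<mu> a * (nbr_sum (\<lambda>_. 1) a * m - C) / \<omega> a b \<le> v b"
proof -
  have V: "a \<in> pverts G" "b \<in> pverts G" using ab wellformed' by auto
  have "nbr_sum (\<lambda>_. 1) a * m \<le> nbr_sum (\<lambda>_. 1) a * v a"
    using nbr_sum_one_nonneg[OF V(1)] m by (rule mult_left_mono[rotated])
  then have "nbr_sum (\<lambda>_. 1) a * m - C \<le> nbr_sum v a"
    using lap by (simp add: laplacian_eq)
  then have "\<mu> a * (nbr_sum (\<lambda>_. 1) a * m - C) \<le> \<mu> a * nbr_sum v a"
    using measure_pos[OF V(1)] by simp
  also have "\<dots> = (\<Sum>y\<in>nbrs a. \<omega> a y * v y)"
    using measure_pos[OF V(1)] by (simp add: nbr_sum_def)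
  also have "\<dots> = \<omega> a b * v b + (\<Sum>y\<in>nbrs a - {b}. \<omega> a y * v y)"
    using ab V finite_nbrs by (intro sum.remove) auto
  also have "(\<Sum>y\<in>nbrs a - {b}. \<omega> a y * v y) \<le> 0"
    using neg weight_pos by (intro sum_nonpos) (auto simp: mult_le_0_iff less_imp_le)
  finally show ?thesis using weight_pos[OF ab] by (simp add: pos_divide_le_eq mult.commute)
qed

text \<open>\<open>harnack_step\<close> is iterated along a path from a vertex where
  \<open>v\<close> is at least \<open>m\<close>. The point is that \<open>B\<close> does not depend
  on \<open>v\<close>.\<close>

lemma uniform_lower_bound:
  assumes y: "y \<in> pverts G"
  shows "\<exists>B. \<forall>v. (\<forall>x\<in>pverts G. v x \<le> 0 \<and> - C \<le> laplacian v x) \<longrightarrow>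
           (\<exists>x\<in>pverts G. m \<le> v x) \<longrightarrow> B \<le> v y"
proof -
  let ?Q = "\<lambda>v. \<forall>x\<in>pverts G. v x \<le> 0 \<and> - C \<le> laplacian v x"
  have "\<exists>B. \<forall>v. ?Q v \<longrightarrow> m \<le> v x \<longrightarrow> B \<le> v y" if x: "x \<in> pverts G" for x
  proof (rule vertex_induct[OF x y, of "\<lambda>z. \<exists>B. \<forall>v. ?Q v \<longrightarrow> m \<le> v x \<longrightarrow> B \<le> v z"])
    fix a b assume ab: "(a, b) \<in> parcs G" and "\<exists>B. \<forall>v. ?Q v \<longrightarrow> m \<le> v x \<longrightarrow> B \<le> v a"
    then obtain B where B: "\<And>v. ?Q v \<Longrightarrow> m \<le> v x \<Longrightarrow> B \<le> v a" by blast
    have "\<mu> a * (nbr_sum (\<lambda>_. 1) a * B - C) / \<omega> a b \<le> v b" if "?Q v" "m \<le> v x" for v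
      using harnack_step[OF ab, of v C B] that B[OF that] ab wellformed' by blast
    then show "\<exists>B. \<forall>v. ?Q v \<longrightarrow> m \<le> v x \<longrightarrow> B \<le> v b" by blast
  qed auto
  then obtain B where B: "\<And>x v. x \<in> pverts G \<Longrightarrow> ?Q v \<Longrightarrow> m \<le> v x \<Longrightarrow> B x \<le> v y"
    by metis
  \<comment> \<open>The vertex where \<open>v\<close> is at least \<open>m\<close> may vary with
    \<open>v\<close>; the minimum over the finitely many candidates removes this dependence.\<close>
  have "Min (B ` pverts G) \<le> v y" if "?Q v" "x \<in> pverts G" "m \<le> v x" for v x
      proof -
    have "Min (B ` pverts G) \<le> B x" using that(2) pair_finite_verts by simp
    then show ?thesis using B[OF that(2,1,3)] by linarith
  qed
  then show ?thesis by blast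
qed

text \<open>If \<open>u\<close> were below \<open>ln d\<close> everywhere,
  \<open>h_fun_le_exp\<close> would make the left side of \<open>integral_identity\<close> smaller
  than the mass \<open>R\<close>. The threshold is chosen so that
  \<open>K * graph_volume G \<mu> * d = R\<close>.\<close>

lemma exact_solution_somewhere_large:
  assumes sol: "exact_solution \<rho> lam u" and lam: "0 < lam" "lam \<le> K"
    and mass: "0 < (\<Sum>x\<in>pverts G. \<mu> x * \<rho> x)"
  shows "\<exists>x\<in>pverts G. ln ((\<Sum>x\<in>pverts G. \<mu> x * \<rho> x) / (K * graph_volume G \<mu>)) \<le> u x"
proof (rule ccontr)
  define R where "R = (\<Sum>x\<in>pverts G. \<mu> x * \<rho> x)"
  define d where "d = R / (K * graph_volume G \<mu>)"
  have d: "0 < d" using mass lam volume_pos by (simp add: d_def R_def)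
  assume "\<not> ?thesis"
  then have less: "u x < ln d" if "x \<in> pverts G" for x
    using that by (auto simp: d_def R_def not_le)
  have h: "h_fun (u x) < d" if "x \<in> pverts G" for x
  proof -
    have "h_fun (u x) \<le> exp (u x)"
      using sol that by (intro h_fun_le_exp) (simp add: exact_solution_def)
    also have "\<dots> < exp (ln d)" using less[OF that] by simp
    finally show ?thesis using d by simp
  qed
  have "(\<Sum>x\<in>pverts G. \<mu> x * h_fun (u x)) < (\<Sum>x\<in>pverts G. \<mu> x * d)"
    using pair_finite_verts verts_nonempty h measure_pos by (intro sum_strict_mono) auto
  also have "\<dots> = graph_volume G \<mu> * d" by (simp add: graph_volume_def sum_distrib_right)
  finally have "R < lam * (graph_volume G \<mu> * d)"
    using lam by (simp add: R_def flip: integral_identity[OF sol])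
  also have "\<dots> \<le> K * (graph_volume G \<mu> * d)"
    using lam d volume_pos by (intro mult_right_mono) auto
  also have "\<dots> = R" using lam volume_pos by (simp add: d_def)
  finally show False by simp
qed

section \<open>Limits of solutions and the critical parameter\<close>

lemma exact_solution_limit:
  assumes lim_lam: "l \<longlonglongrightarrow> lam" and sol: "\<And>n. exact_solution \<rho> (l n) (w n)"
    and lim: "\<And>x. x \<in> pverts G \<Longrightarrow> (\<lambda>n. w n x) \<longlonglongrightarrow> u x"
  shows "exact_solution \<rho> lam u"
  unfolding exact_solution_def
proof (intro ballI conjI)
  fix x assume x: "x \<in> pverts G"
  have le: "w n x \<le> 0" for n using sol x by (simp add: exact_solution_def)
  show "u x \<le> 0" using LIMSEQ_le_const2[OF lim[OF x]] le by blast
  have "(\<lambda>n. laplacian (w n) x) \<longlonglongrightarrow> laplacian u x"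
    unfolding graph_laplacian_def using lim x by (intro tendsto_intros) auto
  moreover have "(\<lambda>n. laplacian (w n) x) = (\<lambda>n. - l n * h_fun (w n x) + \<rho> x)"
    using sol x by (auto simp: exact_solution_def)
  moreover have "(\<lambda>n. - l n * h_fun (w n x) + \<rho> x) \<longlonglongrightarrow> - lam * h_fun (u x) + \<rho> x"
    by (intro tendsto_intros lim_lam tendsto_h_fun lim x le)
  ultimately show "laplacian u x = - lam * h_fun (u x) + \<rho> x"
    using LIMSEQ_unique by metis
qed

text \<open>Monotonicity replaces a compactness argument: maximal solutions for parameters
  decreasing to \<open>lam\<close> decrease pointwise, and the a priori bounds keep them from
  escaping to minus infinity.\<close>

lemma exact_solution_at_infimum:
  assumes lam: "0 < lam"
    and \<rho>: "\<And>x. x \<in> pverts G \<Longrightarrow> 0 \<le> \<rho> x"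
    and mass: "0 < (\<Sum>x\<in>pverts G. \<mu> x * \<rho> x)"
    and ex: "\<And>lam'. lam < lam' \<Longrightarrow> \<exists>u. lower_solution \<rho> lam' u"
  shows "\<exists>u. exact_solution \<rho> lam u"
proof -
  define l where "l n = lam + 1 / real (Suc n)" for n
  have l: "lam < l n" "0 < l n" "l n \<le> lam + 1" "l (Suc n) \<le> l n" for n
    using lam by (auto simp: l_def frac_le add_pos_pos intro!: divide_right_mono)
  have "\<exists>w. exact_solution \<rho> (l n) w \<and>
      (\<forall>v x. lower_solution \<rho> (l n) v \<longrightarrow> x \<in> pverts G \<longrightarrow> v x \<le> w x)" for n
  proof -
    obtain v where "lower_solution \<rho> (l n) v" using ex[OF l(1)] by blast
    from maximal_solution[OF l(2) \<rho> this] show ?thesis by blast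
  qed
  then obtain w where sol: "\<And>n. exact_solution \<rho> (l n) (w n)"
    and max: "\<And>n v x. lower_solution \<rho> (l n) v \<Longrightarrow> x \<in> pverts G \<Longrightarrow> v x \<le> w n x"
    by metis
  define m where "m = ln ((\<Sum>x\<in>pverts G. \<mu> x * \<rho> x) / ((lam + 1) * graph_volume G \<mu>))"
  \<comment> \<open>Crude bound independent of \<open>n\<close>: \<open>\<rho>\<close> is
    nonnegative, \<open>h_fun\<close> is at most 1, and \<open>l n\<close> is at most
    \<open>lam + 1\<close>.\<close>
  have lap: "w n x \<le> 0 \<and> - (lam + 1) \<le> laplacian (w n) x" if x: "x \<in> pverts G" for n x
  proof -
    have "w n x \<le> 0" using sol x by (simp add: exact_solution_def)
    then have "l n * h_fun (w n x) \<le> (lam + 1) * 1"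
      using l[of n] h_fun_le[of "w n x"] lam by (intro mult_mono) (auto simp: h_fun_nonneg)
    then show ?thesis using sol[of n] x \<rho>[OF x] by (force simp: exact_solution_def)
  qed
  have "convergent (\<lambda>n. w n x)" if x: "x \<in> pverts G" for x
  proof -
    obtain B where B: "\<And>v. \<forall>x\<in>pverts G. v x \<le> 0 \<and> - (lam + 1) \<le> laplacian v x \<Longrightarrow>
        \<exists>x\<in>pverts G. m \<le> v x \<Longrightarrow> B \<le> v x"
      using uniform_lower_bound[OF x] by meson
    have "B \<le> w n x" for n
      using lap exact_solution_somewhere_large[OF sol l(2) l(3) mass]
      by (intro B) (auto simp: m_def)
    \<comment> \<open>The solution for the smaller parameter \<open>l (Suc n)\<close> is a lower
      solution for \<open>l n\<close>, hence lies below the maximal one.\<close>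
    moreover have "decseq (\<lambda>n. w n x)"
      using max[OF lower_solution_mono[OF exact_imp_lower[OF sol] l(4)] x]
      by (intro decseq_SucI) blast
    ultimately show ?thesis using decseq_convergent convergentI by metis
  qed
  then have lim_w: "(\<lambda>n. w n x) \<longlonglongrightarrow> lim (\<lambda>n. w n x)" if "x \<in> pverts G" for x
    using that convergent_LIMSEQ_iff by blast
  have "l \<longlonglongrightarrow> lam"
    unfolding l_def using tendsto_add[OF tendsto_const LIMSEQ_inverse_real_of_nat, of lam]
    by (simp add: inverse_eq_divide)
  then have "exact_solution \<rho> lam (\<lambda>x. lim (\<lambda>n. w n x))"
    using sol lim_w by (rule exact_solution_limit)
  then show ?thesis by blast
qed

lemma constant_lower_solution:
  assumes \<rho>: "\<And>x. x \<in> pverts G \<Longrightarrow> 0 \<le> \<rho> x"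
  shows "\<exists>lam>0. \<exists>u. lower_solution \<rho> lam u"
proof -
  \<comment> \<open>The value of \<open>c\<close> at which \<open>h_fun\<close> attains its maximum
    \<open>4/27\<close>; the factor \<open>27/4\<close> in \<open>lam\<close> cancels it. The sum of
    \<open>\<rho>\<close> dominates each of its values, and the summand 1 ensures
    \<open>0 < lam\<close>.\<close>
  define c where "c = f_fun (ln (1 / 3))"
  define lam where "lam = 1 + 27 / 4 * (\<Sum>x\<in>pverts G. \<rho> x)"
  have neg: "ln (1 / 3 :: real) \<le> 0" by simp
  have c: "c \<le> 0" using bij_betw_apply[OF f_fun_bij] neg by (simp add: c_def)
  have h: "h_fun c = 4 / 27"
    using g_fun_inverse(1)[OF neg] by (simp add: h_fun_def c_def power2_eq_square)
  have "\<rho> x \<le> lam * h_fun c" if "x \<in> pverts G" for x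
    using member_le_sum[of x "pverts G" \<rho>] that \<rho> pair_finite_verts by (simp add: lam_def h)
  moreover have "laplacian (\<lambda>_. c) x = 0" for x by (simp add: graph_laplacian_def)
  moreover have "0 < lam" using sum_nonneg[of "pverts G" \<rho>] \<rho> by (simp add: lam_def add_pos_nonneg)
  ultimately have "0 < lam \<and> lower_solution \<rho> lam (\<lambda>_. c)"
    using c by (simp add: lower_solution_def)
  then show ?thesis by blast
qed

theorem critical_parameter:
  assumes \<rho>: "\<And>x. x \<in> pverts G \<Longrightarrow> 0 \<le> \<rho> x"
    and mass: "0 < (\<Sum>x\<in>pverts G. \<mu> x * \<rho> x)"
  obtains lam_c where "27 / 4 * (\<Sum>x\<in>pverts G. \<mu> x * \<rho> x) / graph_volume G \<mu> \<le> lam_c"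
    and "\<And>lam. lam_c \<le> lam \<Longrightarrow> \<exists>u. exact_solution \<rho> lam u"
    and "\<And>lam u. 0 < lam \<Longrightarrow> lam < lam_c \<Longrightarrow> \<not> exact_solution \<rho> lam u"
proof -
  define \<Lambda> where "\<Lambda> = {lam. 0 < lam \<and> (\<exists>u. exact_solution \<rho> lam u)}"
  define b where "b = 27 / 4 * (\<Sum>x\<in>pverts G. \<mu> x * \<rho> x) / graph_volume G \<mu>"
  have lower: "lam \<in> \<Lambda>" if "0 < lam" "lower_solution \<rho> lam u" for lam u
    using maximal_solution[OF that(1) \<rho> that(2)] that(1) unfolding \<Lambda>_def by blast
  have ne: "\<Lambda> \<noteq> {}" using constant_lower_solution[of \<rho>] \<rho> lower by blast
  have b_le: "b \<le> lam" if "lam \<in> \<Lambda>" for lam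
    using that lam_bound by (auto simp: \<Lambda>_def b_def)
  then have bdd: "bdd_below \<Lambda>" by (rule bdd_belowI)
  have b_Inf: "b \<le> Inf \<Lambda>" using ne b_le by (rule cInf_greatest)
  \<comment> \<open>Positivity of the infimum is what allows the limit argument to be applied at
    \<open>Inf \<Lambda>\<close> itself.\<close>
  have "0 < b" using mass volume_pos by (simp add: b_def)
  with b_Inf have Inf_pos: "0 < Inf \<Lambda>" by simp
  have above: "\<exists>u. exact_solution \<rho> lam u" if "Inf \<Lambda> < lam" for lam
  proof -
    obtain lam' where lam': "lam' \<in> \<Lambda>" "lam' < lam"
      using cInf_lessD[OF ne \<open>Inf \<Lambda> < lam\<close>] by blast
    then obtain u where "lower_solution \<rho> lam' u"
      using exact_imp_lower by (auto simp: \<Lambda>_def)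
    then have "lower_solution \<rho> lam u"
      using lam'(2) lower_solution_mono by force
    then show ?thesis using lower that Inf_pos by (force simp: \<Lambda>_def)
  qed
  then have "\<exists>u. exact_solution \<rho> (Inf \<Lambda>) u"
    using exact_imp_lower by (intro exact_solution_at_infimum[OF Inf_pos \<rho> mass]) blast+
  then have "\<exists>u. exact_solution \<rho> lam u" if "Inf \<Lambda> \<le> lam" for lam
    using above that by (cases "lam = Inf \<Lambda>") auto
  moreover have "\<not> exact_solution \<rho> lam u" if "0 < lam" "lam < Inf \<Lambda>" for lam u
    using that cInf_lower[OF _ bdd, of lam] by (auto simp: \<Lambda>_def)
  ultimately show ?thesis using that b_Inf unfolding b_def by blast
qed

end

section \<open>Specialisation to Dirac masses\<close>

lemma integral_dirac_masses:
  assumes "finite V" "\<And>j. j \<in> {1..N} \<Longrightarrow> p j \<in> V \<and> \<mu> (p j) \<noteq> 0"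
  shows "(\<Sum>x\<in>V. \<mu> x * (\<Sum>j = 1..N. dirac_mass \<mu> (p j) x)) = real N"
proof -
  have "(\<Sum>x\<in>V. \<mu> x * (\<Sum>j = 1..N. dirac_mass \<mu> (p j) x))
      = (\<Sum>j = 1..N. \<Sum>x\<in>V. \<mu> x * dirac_mass \<mu> (p j) x)"
    unfolding sum_distrib_left by (rule sum.swap)
  also have "\<dots> = (\<Sum>j = 1..N. 1)"
  proof (rule sum.cong[OF refl])
    fix j assume "j \<in> {1..N}"
    then show "(\<Sum>x\<in>V. \<mu> x * dirac_mass \<mu> (p j) x) = 1"
      using assms by (simp add: dirac_mass_def if_distrib[of "(*) _"] sum.delta' cong: if_cong)
  qed
  finally show ?thesis by simp
qed

theorem theorem1p1:
  fixes G :: "'a pair_pre_digraph"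
    and \<omega> :: "'a \<Rightarrow> 'a \<Rightarrow> real" and \<mu> :: "'a \<Rightarrow> real"
    and N :: nat and p :: "nat \<Rightarrow> 'a"
  assumes "connected_weighted_graph G \<omega> \<mu>"
    and "N \<ge> 1"
    and "\<And>j. j \<in> {1..N} \<Longrightarrow> p j \<in> pverts G"
    and "inj_on p {1..N}"
  shows "\<exists>lam_c :: real. lam_c \<ge> 27 * pi * real N / graph_volume G \<mu> \<and>
    (\<forall>lam \<ge> lam_c. \<exists>u. is_solution G \<omega> \<mu> N p lam u \<and> (\<forall>x\<in>pverts G. u x < 0)) \<and>
    (\<forall>lam. 0 < lam \<and> lam < lam_c \<longrightarrow> \<not> (\<exists>u. is_solution G \<omega> \<mu> N p lam u))"
proof -
  interpret connected_weighted_graph G \<omega> \<mu> by (rule assms(1))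
  define \<rho> where "\<rho> x = 4 * pi * (\<Sum>j = 1..N. dirac_mass \<mu> (p j) x)" for x
  have sol: "is_solution G \<omega> \<mu> N p lam u \<longleftrightarrow> exact_solution \<rho> lam u" for lam u
    by (simp add: is_solution_def exact_solution_def \<rho>_def h_fun_def mult.assoc)
  have \<mu>: "p j \<in> pverts G \<and> 0 < \<mu> (p j)" if "j \<in> {1..N}" for j
    using assms(3)[OF that] measure_pos by simp
  have \<rho>: "0 \<le> \<rho> x" for x
    unfolding \<rho>_def using \<mu>
    by (intro mult_nonneg_nonneg sum_nonneg) (auto simp: dirac_mass_def less_imp_le)
  have "(\<Sum>x\<in>pverts G. \<mu> x * (\<Sum>j = 1..N. dirac_mass \<mu> (p j) x)) = real N"
    using \<mu> pair_finite_verts by (intro integral_dirac_masses) force+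
  \<comment> \<open>With this total mass the general bound \<open>27/4\<close> times mass over
    volume becomes \<open>27 * pi * N\<close> over volume.\<close>
  then have int: "(\<Sum>x\<in>pverts G. \<mu> x * \<rho> x) = 4 * pi * real N"
    by (simp add: \<rho>_def mult.left_commute[of "\<mu> _"] flip: sum_distrib_left)
  then have mass: "0 < (\<Sum>x\<in>pverts G. \<mu> x * \<rho> x)" using assms(2) by simp
  obtain lam_c where "27 * pi * real N / graph_volume G \<mu> \<le> lam_c"
    and "\<And>lam. lam_c \<le> lam \<Longrightarrow> \<exists>u. exact_solution \<rho> lam u"
    and "\<And>lam u. 0 < lam \<Longrightarrow> lam < lam_c \<Longrightarrow> \<not> exact_solution \<rho> lam u"
    using critical_parameter[OF \<rho> mass] by (auto simp: int mult_ac)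
  then show ?thesis
    using exact_solution_negative[OF _ \<rho> mass] unfolding sol by metis
qed

end
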